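(* Let $r,s$ be indeterminates and define the matrices $$ L' = \begin{bmatrix} 1 & 0\\ r & s \end{bmatrix} \quad\text{and}\quad R' = \begin{bmatrix} r & s\\ 0 & 1 \end{bmatrix}. $$ For $n\ge1$ with binary expansion $\beta(n)=b_1 b_2\ldots b_k$ (so $b_1=1$, and $n=\sum_{i=1}^k b_i 2^{k-i}$), let $M'(n)$ be the matrix product obtained by removing the initial $1$ from $\beta(n)$, reading the remaining digits backwards as $b_k b_{k-1}\ldots b_2$, and replacing each $0$ by $L'$ and each $1$ by $R'$ (the empty product being the identity matrix). A hyperbinary expansion of $n$ is a word $d=d_1d_2\ldots d_k$ of the same length $k$ as $\beta(n)$ with each $d_i\in\{0,1,2\}$ and $n=\sum_{i=1}^k d_i 2^{k-i}$; let ${\cal D}(n)$ be the set of hyperbinary expansions of $n$. For such $d$, let $t(d)$ be the number of twos in $d$, and $z(d)$ the number of nonleading zeros in $d$ (the number of zeros to the right of the leftmost nonzero digit of $d$). Define $$ h_{rs}(n) = \sum_{d\in{\cal D}(n)} r^{t(d)} s^{z(d)}. $$ Then $h_{rs}(-1)=0$, $h_{rs}(0) = 1$, and for $n\ge1$ \begin{align*} h_{rs}(2n-1) &= h_{rs}(n-1),\\ h_{rs}(2n) &= s\, h_{rs}(n) + r\, h_{rs}(n-1). \end{align*} Moreover, for all $n\ge0$, $$ M'(n) \begin{bmatrix} 1\\ 1 \end{bmatrix} = \begin{bmatrix} h_{rs}(n-1)\\ h_{rs}(n) \end{bmatrix}. $$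
   Context: The paper writes the generating function as $H_{rs}(n)$ in its definition but as $h_{rs}(n)$ in the theorem; they denote the same function. The matrices $L',R'$ generalize the $q$-analogues $L=\begin{bmatrix}1&0\\1&q^{-1}\end{bmatrix}$, $R=\begin{bmatrix}q&1\\0&1\end{bmatrix}$ of the standard generators of $\mathrm{SL}(2,\mathbb{R})$.
   Formalization: The matrix identity is proved for all n ≥ 1 rather than n ≥ 0: M'(0) is not defined, and taking it as the identity or as L' gives (1,1) or (1,r+s), not (h(-1),h(0)) = (0,1). *)

theory Defs
  imports "HOL-Analysis.Analysis"
begin

text \<open>
  The indeterminates are rendered as arbitrary elements \<open>r\<close>, \<open>s\<close> of an arbitrary commutative
  ring. Taking for \<open>r\<close>, \<open>s\<close> the two variables of a polynomial ring such as \<open>int poly poly\<close>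
  gives the case of formal indeterminates.
\<close>

definition L_mat :: "'a \<Rightarrow> 'a \<Rightarrow> 'a::comm_ring_1^2^2" where
  "L_mat r s = vector [vector [1, 0], vector [r, s]]"

definition R_mat :: "'a \<Rightarrow> 'a \<Rightarrow> 'a::comm_ring_1^2^2" where
  "R_mat r s = vector [vector [r, s], vector [0, 1]]"

text \<open>
  Words list the most significant digit first, so in a word of length \<open>k\<close> the digit at
  (zero-based) list position \<open>i\<close> has weight \<open>2 ^ (k - (i + 1))\<close>.
\<close>

definition word_value :: "nat list \<Rightarrow> nat" where
  "word_value d = (\<Sum>i<length d. d ! i * 2 ^ (length d - Suc i))"

text \<open>The binary expansion, without leading zeros; that of \<open>0\<close> is the empty word.\<close>

fun beta :: "nat \<Rightarrow> nat list" where
  "beta n = (if n = 0 then [] else beta (n div 2) @ [n mod 2])"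

declare beta.simps [simp del]

lemma word_value_snoc: "word_value (d @ [x]) = 2 * word_value d + x"
proof -
  have "(\<Sum>i<length d. (d @ [x]) ! i * 2 ^ (length d - i)) =
        (\<Sum>i<length d. 2 * (d ! i * 2 ^ (length d - Suc i)))"
    by (rule sum.cong) (auto simp: nth_append Suc_diff_Suc simp flip: power_Suc)
  then show ?thesis
    by (simp add: word_value_def sum_distrib_left)
qed

lemma word_value_beta: "word_value (beta n) = n"
proof (induction n rule: beta.induct)
  case (1 n)
  then show ?case
    by (subst beta.simps) (auto simp: word_value_snoc, simp add: word_value_def)
qed

lemma set_beta: "set (beta n) \<subseteq> {0, 1}"
proof (induction n rule: beta.induct)
  case (1 n)
  then show ?case
    by (subst beta.simps) auto
qed

lemma hd_beta: "n \<ge> 1 \<Longrightarrow> beta n \<noteq> [] \<and> hd (beta n) = 1"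
proof (induction n rule: beta.induct)
  case (1 n)
  show ?case
  proof (cases "n = 1")
    case True
    then show ?thesis by (simp add: beta.simps)
  next
    case False
    with 1 have "beta (n div 2) \<noteq> [] \<and> hd (beta (n div 2)) = 1" by simp
    then show ?thesis using 1(2) by (subst (1 2) beta.simps) simp
  qed
qed

text \<open>
  The leftmost factor comes from the last binary digit. Only meaningful for \<open>n \<ge> 1\<close>, where \<open>tl\<close> removes the initial digit \<open>1\<close>.
\<close>

definition M_mat :: "'a \<Rightarrow> 'a \<Rightarrow> nat \<Rightarrow> 'a::comm_ring_1^2^2" where
  "M_mat r s n =
     foldr (\<lambda>b A. (if b = 0 then L_mat r s else R_mat r s) ** A) (rev (tl (beta n))) (mat 1)"

text \<open>
  The argument is an integer so that the generating function can be evaluated at \<open>-1\<close>.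
  A negative integer has no hyperbinary expansion, whatever length is prescribed.
\<close>

definition hyperbinary :: "int \<Rightarrow> nat list set" where
  "hyperbinary n =
     {d. length d = length (beta (nat n)) \<and> set d \<subseteq> {0, 1, 2} \<and> int (word_value d) = n}"

lemma finite_hyperbinary: "finite (hyperbinary n)"
proof (rule finite_subset)
  show "hyperbinary n \<subseteq> {d. set d \<subseteq> {0, 1, 2} \<and> length d = length (beta (nat n))}"
    by (auto simp: hyperbinary_def)
qed (simp add: finite_lists_length_eq)

definition twos :: "nat list \<Rightarrow> nat" where
  "twos d = count_list d 2"

definition nonleading_zeros :: "nat list \<Rightarrow> nat" where
  "nonleading_zeros d = count_list (dropWhile (\<lambda>x. x = 0) d) 0"

definition h_rs :: "'a \<Rightarrow> 'a \<Rightarrow> int \<Rightarrow> 'a::comm_ring_1" where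
  "h_rs r s n = (\<Sum>d\<in>hyperbinary n. r ^ twos d * s ^ nonleading_zeros d)"

end

theory Submission imports Defs begin

text \<open>
  Deleting the last digit of a hyperbinary expansion yields both recurrences, except that for \<open>n\<close> a
  power of two the prefixes of value \<open>n - 1\<close> are one digit longer than \<open>beta (n - 1)\<close>. Such words
  have a leading zero, which does not affect the weight, so it is convenient to sum over words of
  arbitrary prescribed length. The matrix identity is these recurrences written as
  multiplication by \<open>L_mat\<close> and \<open>R_mat\<close>.
\<close>

definition hyperbinary_words :: "nat \<Rightarrow> nat \<Rightarrow> nat list set" where
  "hyperbinary_words k n = {d. length d = k \<and> set d \<subseteq> {0, 1, 2} \<and> word_value d = n}"

definition word_weight :: "'a \<Rightarrow> 'a \<Rightarrow> nat list \<Rightarrow> 'a::comm_ring_1" where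
  "word_weight r s d = r ^ twos d * s ^ nonleading_zeros d"

lemma word_value_Nil [simp]: "word_value [] = 0"
  by (simp add: word_value_def)

lemma word_value_Cons: "word_value (x # d) = x * 2 ^ length d + word_value d"
  by (simp add: word_value_def sum.lessThan_Suc_shift del: sum.lessThan_Suc)

lemma word_value_eq_0: "\<forall>x\<in>set d. x = 0 \<Longrightarrow> word_value d = 0"
  by (induction d) (auto simp: word_value_Cons)

lemma beta_0: "beta 0 = []"
  by (simp add: beta.simps)

lemma beta_double: "m \<ge> 1 \<Longrightarrow> beta (2 * m) = beta m @ [0]"
  by (subst beta.simps) simp

lemma beta_double_Suc: "beta (Suc (2 * m)) = beta m @ [1]"
  by (subst beta.simps) simp

lemma less_power_length_beta: "n < 2 ^ length (beta n)"
proof (induction n rule: beta.induct)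
  case (1 n)
  then show ?case
    by (cases "n = 0") (simp_all add: beta.simps[of n])
qed

text \<open>Used to see that a length chosen for one number is also long enough for its
  predecessor.\<close>

lemma length_beta_le: "n < 2 ^ k \<Longrightarrow> length (beta n) \<le> k"
proof (induction k arbitrary: n)
  case 0
  then show ?case by (simp add: beta_0)
next
  case (Suc k)
  then have "n div 2 < 2 ^ k" by (simp add: less_mult_imp_div_less)
  from Suc.IH[OF this] show ?case
    by (subst beta.simps) simp
qed

lemma hyperbinary_eq_words: "hyperbinary (int n) = hyperbinary_words (length (beta n)) n"
  by (simp add: hyperbinary_def hyperbinary_words_def)

lemma hyperbinary_negative: "n < 0 \<Longrightarrow> hyperbinary n = {}"
  by (auto simp: hyperbinary_def)

lemma finite_hyperbinary_words: "finite (hyperbinary_words k n)"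
  by (rule finite_subset[where B = "{d. set d \<subseteq> {0, 1, 2} \<and> length d = k}"])
     (auto simp: hyperbinary_words_def finite_lists_length_eq)

text \<open>A nonzero first digit of a word of length \<open>Suc k\<close> already contributes at
  least \<open>2 ^ k\<close>, which exceeds \<open>n\<close>.\<close>

lemma hyperbinary_words_pad:
  assumes "n < 2 ^ k"
  shows "hyperbinary_words (Suc k) n = (#) 0 ` hyperbinary_words k n"
proof (intro equalityI subsetI)
  fix d assume d: "d \<in> hyperbinary_words (Suc k) n"
  then obtain x e where e: "d = x # e" "length e = k"
    by (auto simp: hyperbinary_words_def length_Suc_conv)
  with d have "x * 2 ^ k + word_value e = n"
    by (simp add: hyperbinary_words_def word_value_Cons)
  with assms have "x = 0" by (cases x) auto
  with d e show "d \<in> (#) 0 ` hyperbinary_words k n"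
    by (auto simp: hyperbinary_words_def word_value_Cons)
qed (auto simp: hyperbinary_words_def word_value_Cons)

lemma hyperbinary_words_snocE:
  assumes "d \<in> hyperbinary_words (Suc k) n"
  obtains e x where "d = e @ [x]" "length e = k" "set e \<subseteq> {0, 1, 2}" "x \<in> {0, 1, 2}"
    "2 * word_value e + x = n"
proof (cases d rule: rev_cases)
  case Nil
  then show ?thesis using assms by (simp add: hyperbinary_words_def)
next
  case (snoc e x)
  then show ?thesis using assms that[of e x]
    by (auto simp: hyperbinary_words_def word_value_snoc)
qed

text \<open>The last digit has the parity of the value, and 1 is the only odd digit.\<close>

lemma hyperbinary_words_odd:
  "hyperbinary_words (Suc k) (Suc (2 * m)) = (\<lambda>d. d @ [1]) ` hyperbinary_words k m"
proof (intro equalityI subsetI)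
  fix d assume "d \<in> hyperbinary_words (Suc k) (Suc (2 * m))"
  then obtain e x where e: "d = e @ [x]" "length e = k" "set e \<subseteq> {0, 1, 2}" "x \<in> {0, 1, 2}"
    "2 * word_value e + x = Suc (2 * m)" by (rule hyperbinary_words_snocE)
  then have "x = 1" "word_value e = m" by (auto, presburger+)
  with e show "d \<in> (\<lambda>d. d @ [1]) ` hyperbinary_words k m"
    by (auto simp: hyperbinary_words_def)
qed (auto simp: hyperbinary_words_def word_value_snoc)

text \<open>Both 0 and 2 are possible last digits of an even value; a final 2 takes one unit away
  from the prefix. Writing the value as \<open>2 * Suc m\<close> ensures that this smaller prefix
  value exists.\<close>

lemma hyperbinary_words_even:
  "hyperbinary_words (Suc k) (2 * Suc m) =
     (\<lambda>d. d @ [0]) ` hyperbinary_words k (Suc m) \<union> (\<lambda>d. d @ [2]) ` hyperbinary_words k m"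
proof (intro equalityI subsetI)
  fix d assume "d \<in> hyperbinary_words (Suc k) (2 * Suc m)"
  then obtain e x where e: "d = e @ [x]" "length e = k" "set e \<subseteq> {0, 1, 2}" "x \<in> {0, 1, 2}"
    "2 * word_value e + x = 2 * Suc m" by (rule hyperbinary_words_snocE)
  then have "x = 0 \<and> word_value e = Suc m \<or> x = 2 \<and> word_value e = m" by (auto, presburger+)
  with e show "d \<in> (\<lambda>d. d @ [0]) ` hyperbinary_words k (Suc m) \<union>
      (\<lambda>d. d @ [2]) ` hyperbinary_words k m"
    by (auto simp: hyperbinary_words_def)
qed (auto simp: hyperbinary_words_def word_value_snoc)

lemma word_weight_Cons_0: "word_weight r s (0 # d) = word_weight r s d"
  by (simp add: word_weight_def twos_def nonleading_zeros_def)

lemma nonleading_zeros_snoc_nonzero: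
  "x \<noteq> 0 \<Longrightarrow> nonleading_zeros (d @ [x]) = nonleading_zeros d"
  by (induction d) (auto simp: nonleading_zeros_def)

text \<open>If \<open>d\<close> consisted of zeros only, the appended zero would still be leading
  and would not count.\<close>

lemma nonleading_zeros_snoc_0:
  "\<exists>x\<in>set d. x \<noteq> 0 \<Longrightarrow> nonleading_zeros (d @ [0]) = Suc (nonleading_zeros d)"
  by (induction d) (auto simp: nonleading_zeros_def)

lemma word_weight_snoc_1: "word_weight r s (d @ [1]) = word_weight r s d"
  by (simp add: word_weight_def twos_def nonleading_zeros_snoc_nonzero)

lemma word_weight_snoc_2: "word_weight r s (d @ [2]) = r * word_weight r s d"
  by (simp add: word_weight_def twos_def nonleading_zeros_snoc_nonzero algebra_simps)

lemma word_weight_snoc_0: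
  assumes "word_value d \<noteq> 0"
  shows "word_weight r s (d @ [0]) = s * word_weight r s d"
proof -
  have "\<exists>x\<in>set d. x \<noteq> 0" using assms word_value_eq_0[of d] by metis
  then show ?thesis
    by (simp add: word_weight_def twos_def nonleading_zeros_snoc_0 algebra_simps)
qed

text \<open>At length \<open>length (beta n)\<close> this is the definition of \<open>h_rs\<close>.
  Each further position can only hold a leading zero, which preserves the weight.\<close>

lemma sum_hyperbinary_words:
  assumes "length (beta n) \<le> k"
  shows "sum (word_weight r s) (hyperbinary_words k n) = h_rs r s (int n)"
  using assms
proof (induction k rule: dec_induct)
  case base
  show ?case by (simp add: h_rs_def hyperbinary_eq_words word_weight_def)
next
  case (step k)
  have "n < 2 ^ length (beta n)" by (rule less_power_length_beta)
  also have "\<dots> \<le> 2 ^ k" using step.hyps by simp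
  finally show ?case using step.IH
    by (simp add: hyperbinary_words_pad sum.reindex word_weight_Cons_0)
qed

lemma h_rs_odd: "h_rs r s (int (Suc (2 * m))) = h_rs r s (int m)"
proof -
  have "h_rs r s (int (Suc (2 * m))) =
      sum (word_weight r s) (hyperbinary_words (Suc (length (beta m))) (Suc (2 * m)))"
    by (rule sum_hyperbinary_words[symmetric]) (simp add: beta_double_Suc)
  also have "\<dots> = sum (word_weight r s) (hyperbinary_words (length (beta m)) m)"
    \<comment> \<open>The simplifier turns the digit \<open>1\<close> into \<open>Suc 0\<close>, so
      the weight rule is needed in that form.\<close>
    by (simp add: hyperbinary_words_odd sum.reindex inj_on_def word_weight_snoc_1[simplified])
  finally show ?thesis by (simp add: sum_hyperbinary_words)
qed

lemma h_rs_even: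
  "h_rs r s (int (2 * Suc m)) = s * h_rs r s (int (Suc m)) + r * h_rs r s (int m)"
proof -
  \<comment> \<open>One length serves both prefix sums. It exceeds \<open>length (beta m)\<close> by
    one exactly when \<open>Suc m\<close> is a power of two.\<close>
  define k where "k = length (beta (Suc m))"
  have "m < 2 ^ k" using less_power_length_beta[of "Suc m"] by (simp add: k_def)
  then have k: "length (beta m) \<le> k" by (rule length_beta_le)
  have "h_rs r s (int (2 * Suc m)) =
      sum (word_weight r s) (hyperbinary_words (Suc k) (2 * Suc m))"
    by (rule sum_hyperbinary_words[symmetric]) (subst beta_double; simp add: k_def)
  also have "\<dots> = sum (word_weight r s) ((\<lambda>d. d @ [0]) ` hyperbinary_words k (Suc m)) +
      sum (word_weight r s) ((\<lambda>d. d @ [2]) ` hyperbinary_words k m)"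
    unfolding hyperbinary_words_even
    by (rule sum.union_disjoint) (auto simp: finite_hyperbinary_words)
  also have "sum (word_weight r s) ((\<lambda>d. d @ [0]) ` hyperbinary_words k (Suc m)) =
      (\<Sum>d\<in>hyperbinary_words k (Suc m). s * word_weight r s d)"
    \<comment> \<open>The prefixes have value \<open>Suc m\<close>, hence nonzero, so the appended
      zero is nonleading and yields the factor \<open>s\<close>.\<close>
    by (subst sum.reindex)
       (auto simp: inj_on_def hyperbinary_words_def intro!: sum.cong word_weight_snoc_0)
  also have "sum (word_weight r s) ((\<lambda>d. d @ [2]) ` hyperbinary_words k m) =
      (\<Sum>d\<in>hyperbinary_words k m. r * word_weight r s d)"
    by (subst sum.reindex) (auto simp: inj_on_def word_weight_snoc_2)
  finally show ?thesis
    using k by (simp add: sum_hyperbinary_words k_def flip: sum_distrib_left)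
qed

lemma h_rs_0: "h_rs r s 0 = 1"
proof -
  have "hyperbinary 0 = {[]}" by (auto simp: hyperbinary_def beta_0)
  then show ?thesis by (simp add: h_rs_def twos_def nonleading_zeros_def)
qed

text \<open>Reversal makes the new last digit the leftmost factor. Since \<open>beta m\<close> is
  nonempty, \<open>tl\<close> removes its leading digit and not the appended one.\<close>

lemma M_mat_double: "m \<ge> 1 \<Longrightarrow> M_mat r s (2 * m) = L_mat r s ** M_mat r s m"
  using hd_beta[of m] by (simp add: M_mat_def beta_double)

lemma M_mat_double_Suc: "m \<ge> 1 \<Longrightarrow> M_mat r s (Suc (2 * m)) = R_mat r s ** M_mat r s m"
  using hd_beta[of m] by (simp add: M_mat_def beta_double_Suc)

lemma L_mat_mult_vector: "L_mat r s *v vector [x, y] = vector [x, r * x + s * y]"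
  by (simp add: L_mat_def vec_eq_iff forall_2 matrix_vector_mult_def sum_2)

lemma R_mat_mult_vector: "R_mat r s *v vector [x, y] = vector [r * x + s * y, y]"
  by (simp add: R_mat_def vec_eq_iff forall_2 matrix_vector_mult_def sum_2)

text \<open>Indexing by \<open>Suc m\<close> keeps both arguments of \<open>h_rs\<close> natural, so
  that the recurrences apply directly.\<close>

lemma M_mat_mult_ones:
  "M_mat r s (Suc m) *v vector [1, 1] = vector [h_rs r s (int m), h_rs r s (int (Suc m))]"
proof (induction m rule: less_induct)
  case (less m)
  \<comment> \<open>In the last two cases \<open>Suc m\<close> is \<open>2 * Suc l\<close> or
    \<open>Suc (2 * Suc l)\<close>, so stripping its last digit leaves \<open>Suc l\<close>, and the
    induction hypothesis is used at \<open>l\<close>. For \<open>m = 0\<close> no digit follows the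
    initial 1.\<close>
  consider "m = 0" | l where "m = Suc (2 * l)" | l where "m = 2 * Suc l"
    by (metis evenE mult_0_right not0_implies_Suc oddE Suc_eq_plus1)
  then show ?case
  proof cases
    case 1
    have "M_mat r s (Suc 0) = mat 1"
      using beta_double_Suc[of 0] by (simp add: M_mat_def beta_0)
    moreover have "h_rs r s (int (Suc 0)) = 1"
      using h_rs_odd[of r s 0] by (simp add: h_rs_0)
    ultimately show ?thesis
      by (simp only: 1 matrix_vector_mul_lid of_nat_0 h_rs_0)
  next
    case (2 l)
    have "M_mat r s (Suc m) *v vector [1, 1] =
        L_mat r s *v (M_mat r s (Suc l) *v vector [1, 1])"
      using 2 M_mat_double[of "Suc l" r s] by (simp add: matrix_vector_mul_assoc)
    also have "\<dots> = vector [h_rs r s (int m), h_rs r s (int (2 * Suc l))]"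
      using 2 by (simp only: less L_mat_mult_vector h_rs_odd h_rs_even add.commute)
    finally show ?thesis using 2 by simp
  next
    case (3 l)
    have "M_mat r s (Suc m) *v vector [1, 1] =
        R_mat r s *v (M_mat r s (Suc l) *v vector [1, 1])"
      unfolding 3 by (subst M_mat_double_Suc) (simp_all add: matrix_vector_mul_assoc)
    also have "M_mat r s (Suc l) *v vector [1, 1] = vector [h_rs r s (int l), h_rs r s (int (Suc l))]"
      using 3 by (intro less) simp
    also have "R_mat r s *v \<dots> = vector [h_rs r s (int (2 * Suc l)), h_rs r s (int (Suc (2 * Suc l)))]"
      by (simp only: R_mat_mult_vector h_rs_odd h_rs_even add.commute)
    finally show ?thesis using 3 by simp
  qed
qed

text \<open>The matrix identity starts at \<open>n = 1\<close>: at 0 the empty product would give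
  the entries 1, 1, whereas \<open>h_rs\<close> at -1 and 0 gives 0, 1.\<close>

theorem theorem4p4:
  fixes r s :: "'a::comm_ring_1"
  shows "h_rs r s (-1) = 0 \<and> h_rs r s 0 = 1 \<and>
    (\<forall>n::int. n \<ge> 1 \<longrightarrow>
       h_rs r s (2 * n - 1) = h_rs r s (n - 1) \<and>
       h_rs r s (2 * n) = s * h_rs r s n + r * h_rs r s (n - 1)) \<and>
    (\<forall>n::nat. n \<ge> 1 \<longrightarrow>
       M_mat r s n *v vector [1, 1] = (vector [h_rs r s (int n - 1), h_rs r s (int n)] :: 'a^2))"
proof (intro conjI allI impI)
  show "h_rs r s (-1) = 0" by (simp add: h_rs_def hyperbinary_negative)
  show "h_rs r s 0 = 1" by (rule h_rs_0)
next
  fix n :: int assume "n \<ge> 1"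
  then obtain m where n: "n = int (Suc m)"
    by (metis Suc_pred' int_one_le_iff_zero_less pos_int_cases)
  have "2 * n - 1 = int (Suc (2 * m))" "n - 1 = int m" "2 * n = int (2 * Suc m)"
    using n by simp_all
  then show "h_rs r s (2 * n - 1) = h_rs r s (n - 1)"
    and "h_rs r s (2 * n) = s * h_rs r s n + r * h_rs r s (n - 1)"
    using n by (simp_all only: h_rs_odd h_rs_even)
next
  fix n :: nat assume "n \<ge> 1"
  then obtain m where "n = Suc m" by (cases n) auto
  then show "M_mat r s n *v vector [1, 1] = (vector [h_rs r s (int n - 1), h_rs r s (int n)] :: 'a^2)"
    using M_mat_mult_ones[of r s m] by simp
qed

end
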